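(* Let $A\subset\mathbb{N}_{+}$ be a set all of whose elements are odd. Then for all $k,n\in\mathbb{N}$ we have $(-1)^{n}S_{A,k}(n)\geq 0$.
   Context: $\mathbb{N}$ is the set of non-negative integers and $\mathbb{N}_{+}$ the set of positive integers. For $A\subset\mathbb{N}_{+}$ and $i,n\in\mathbb{N}$, $c_{A}(i,n)$ denotes the number of $A$-compositions of $n$ with exactly $i$ parts, i.e. the number of (ordered) sequences $(\lambda_{1},\ldots,\lambda_{i})$ with all $\lambda_{j}\in A$ and $\lambda_{1}+\cdots+\lambda_{i}=n$ (so $c_A(0,0)=1$ and $c_A(0,n)=0$ for $n\ge 1$). For $k,n\in\mathbb{N}$ put $$S_{A,k}(n)=\sum_{i=0}^{n}(-1)^{i}i^{k}c_{A}(i,n),$$ with the convention $0^{0}=1$. *)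

theory Defs
  imports Main
begin

definition compositions :: "nat set \<Rightarrow> nat \<Rightarrow> nat \<Rightarrow> nat list set" where
  "compositions A i n = {xs. length xs = i \<and> set xs \<subseteq> A \<and> sum_list xs = n}"

definition c :: "nat set \<Rightarrow> nat \<Rightarrow> nat \<Rightarrow> nat" where
  "c A i n = card (compositions A i n)"

text \<open>The set counted by \<open>c\<close> is finite for every \<open>A\<close>, so that its \<open>card\<close> is a genuine count.\<close>

lemma finite_compositions: "finite (compositions A i n)"
proof (rule finite_subset)
  show "compositions A i n \<subseteq> {xs. set xs \<subseteq> {..n} \<and> length xs = i}"
    by (auto simp: compositions_def dest: member_le_sum_list)
  show "finite {xs. set xs \<subseteq> {..n} \<and> length xs = i}"
    by (rule finite_lists_length_eq) simp
qed

text \<open>The convention \<open>0 ^ 0 = 1\<close> needed in the term \<open>i = k = 0\<close> is that of the library's power.\<close>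

definition S :: "nat set \<Rightarrow> nat \<Rightarrow> nat \<Rightarrow> int" where
  "S A k n = (\<Sum>i=0..n. (-1) ^ i * int i ^ k * int (c A i n))"

end

theory Submission
  imports Defs
begin

text \<open>A sum of \<open>i\<close> odd numbers has the parity of \<open>i\<close>. If all parts are odd, the only nonzero
  terms of \<open>S A k n\<close> are therefore those with \<open>(-1) ^ i = (-1) ^ n\<close>; multiplication by
  \<open>(-1) ^ n\<close> cancels this common sign and leaves a sum of non-negative numbers.\<close>

lemma even_sum_list_of_odds:
  fixes xs :: "nat list"
  assumes "\<forall>x\<in>set xs. odd x"
  shows "even (sum_list xs) \<longleftrightarrow> even (length xs)"
  using assms by (induction xs) auto

lemma c_nonzero_imp_same_parity:
  assumes "\<forall>a\<in>A. odd a" and "c A i n \<noteq> 0"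
  shows "even n \<longleftrightarrow> even i"
proof -
  from assms(2) obtain xs where "xs \<in> compositions A i n"
    unfolding c_def by fastforce
  then have "length xs = i" "set xs \<subseteq> A" "sum_list xs = n"
    by (auto simp: compositions_def)
  with assms(1) even_sum_list_of_odds[of xs] show ?thesis
    by blast
qed

theorem corollary3p1:
  fixes A :: "nat set" and k n :: nat
  assumes pos: "A \<subseteq> {a. 0 < a}"
    and odd_parts: "\<forall>a\<in>A. odd a"
  shows "(-1) ^ n * S A k n \<ge> 0"
proof -
  have "(-1) ^ n * ((-1) ^ i * int i ^ k * int (c A i n)) \<ge> 0" for i
  proof (cases "c A i n = 0")
    case False
    with odd_parts have "even n \<longleftrightarrow> even i"
      by (rule c_nonzero_imp_same_parity)
    then show ?thesis
      by (cases "even n") auto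
  qed simp
  then show ?thesis
    unfolding S_def sum_distrib_left by (intro sum_nonneg)
qed

end
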